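(* In the group $\mathbb{Z}_3^3$, let $A=\{0,e_1,e_2,e_3\}$, where $e_i$ denotes the $i$-th standard basis vector, and let $S=\partial A$. Then $$S=\{\pm e_i,\ \pm(e_i-e_j)\mid 1\leq i\neq j\leq 3\}$$ and $$i\bigl(\operatorname{Cay}(\mathbb{Z}_3^3,S)\bigr)=3,\qquad \alpha\bigl(\operatorname{Cay}(\mathbb{Z}_3^3,S)\bigr)=4 .$$
   Context: Here $\mathbb{Z}_3=\mathbb{Z}/3\mathbb{Z}$. For a non-empty subset $A$ of an additively written abelian group $G$, $\partial A=\{y-x\mid x,y\in A\}\setminus\{0\}$. For a subset $S\subseteq G$ with $0\notin S$ and $S=-S$, the Cayley graph $\operatorname{Cay}(G,S)$ is the simple graph with vertex set $G$ in which $u,v$ are adjacent if and only if $v-u\in S$. For a finite graph $\Gamma$, $\alpha(\Gamma)$ is the size of a largest independent set and $i(\Gamma)$ is the size of a smallest maximal (with respect to inclusion) independent set. *)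

theory Defs
  imports "HOL-Analysis.Finite_Cartesian_Product" "HOL-Library.Numeral_Type"
    "HOL-Library.Ramsey"
begin

text \<open>
  The numeral type \<open>3\<close> carries arithmetic modulo 3, so it serves as the ring of integers modulo 3.
  It is also used as the index type of the coordinates: its elements are \<open>1\<close>, \<open>2\<close> and \<open>3\<close>,
  where \<open>3\<close> is the same element as \<open>0\<close>. The \<open>i\<close>-th standard basis vector is \<open>axis i 1\<close>.
\<close>

type_synonym Z3 = "3"

lemma Z3_characteristic: "(1 :: Z3) + 1 + 1 = 0" "(1 :: Z3) \<noteq> 0" "CARD(Z3) = 3"
  by simp_all

lemma index_UNIV: "(UNIV :: 3 set) = {1, 2, 3}"
proof -
  have "card {1, 2, 3 :: 3} = CARD(3)"
    by simp
  then show ?thesis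
    by (metis card_subset_eq finite subset_UNIV)
qed

definition difference_set :: "'a::ab_group_add set \<Rightarrow> 'a set" where
  "difference_set A = {y - x | x y. x \<in> A \<and> y \<in> A} - {0}"

text \<open>
  A simple graph is a pair of its vertex set and its set of edges, an edge being a two-element
  set of vertices. This is the edge representation expected by \<^const>\<open>indep\<close>.
\<close>

type_synonym 'a graph = "'a set \<times> 'a set set"

text \<open>Only meaningful if \<open>0 \<notin> S\<close> and \<open>S = - S\<close>; see \<open>Cay_adjacent_iff\<close> and \<open>Cay_edge_card\<close> below.\<close>

definition Cay :: "'a::ab_group_add set \<Rightarrow> 'a graph" where
  "Cay S = (UNIV, {{u, v} | u v. v - u \<in> S})"

definition indep_sets :: "'a graph \<Rightarrow> 'a set set" where
  "indep_sets \<Gamma> = {I. I \<subseteq> fst \<Gamma> \<and> indep I (snd \<Gamma>)}"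

definition maximal_indep_sets :: "'a graph \<Rightarrow> 'a set set" where
  "maximal_indep_sets \<Gamma> = {I \<in> indep_sets \<Gamma>. \<forall>J \<in> indep_sets \<Gamma>. I \<subseteq> J \<longrightarrow> J = I}"

text \<open>The following two numbers are only meaningful for finite graphs.\<close>

definition independence_number :: "'a graph \<Rightarrow> nat" where
  "independence_number \<Gamma> = Max (card ` indep_sets \<Gamma>)"

definition indep_domination_number :: "'a graph \<Rightarrow> nat" where
  "indep_domination_number \<Gamma> = Min (card ` maximal_indep_sets \<Gamma>)"

lemma zero_notin_difference_set: "0 \<notin> difference_set A"
  by (simp add: difference_set_def)

lemma uminus_difference_set: "uminus ` difference_set A = difference_set A"
proof -
  have *: "- z \<in> difference_set A" if "z \<in> difference_set A" for z
    using that unfolding difference_set_def by (auto intro: minus_diff_eq)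
  show ?thesis
  proof
    show "uminus ` difference_set A \<subseteq> difference_set A"
      using * by blast
    show "difference_set A \<subseteq> uminus ` difference_set A"
    proof
      fix z assume "z \<in> difference_set A"
      then show "z \<in> uminus ` difference_set A"
        using *[of z] by (metis image_eqI minus_minus)
    qed
  qed
qed

lemma Cay_adjacent_iff:
  assumes "uminus ` S = S"
  shows "{u, v} \<in> snd (Cay S) \<longleftrightarrow> v - u \<in> S"
proof
  assume "{u, v} \<in> snd (Cay S)"
  then consider "v - u \<in> S" | "u - v \<in> S"
    unfolding Cay_def by (auto simp: doubleton_eq_iff)
  then show "v - u \<in> S"
    by cases (metis assms image_eqI minus_diff_eq)+
next
  assume "v - u \<in> S"
  then show "{u, v} \<in> snd (Cay S)"
    unfolding Cay_def by auto
qed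

lemma Cay_edge_card:
  assumes "0 \<notin> S" "e \<in> snd (Cay S)"
  shows "card e = 2"
proof -
  obtain u v where "e = {u, v}" "v - u \<in> S"
    using assms(2) unfolding Cay_def by auto
  moreover from this assms(1) have "u \<noteq> v"
    by auto
  ultimately show ?thesis
    by simp
qed

end

theory Submission
  imports Defs "HOL-Analysis.Cartesian_Space"
begin

text \<open>
  Let \<open>d = (1, 1, 1)\<close> and sort the vertices by their coordinate sum. The only non-zero vectors of
  sum \<open>0\<close> outside \<open>S\<close> are \<open>d\<close> and \<open>-d\<close>, so an independent set \<open>I\<close> meets each class of vertices of
  equal sum within one coset of \<open>{0, d, -d}\<close>. Conversely, the coset of a vector of non-zero sum
  always meets \<open>S\<close>. Hence two classes cannot both contain two points of \<open>I\<close>, and a class containing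
  three points of \<open>I\<close> is all of \<open>I\<close>. This leaves at most four points, and shows that
  \<open>{0, d, -d}\<close> is a maximal independent set. No maximal independent set is smaller, because the
  graph is regular of degree \<open>12\<close> and \<open>2 * 13 < 27\<close>.
\<close>

section \<open>Independent sets in Cayley graphs\<close>

lemma indep_sets_Cay_iff:
  assumes "0 \<notin> S" and "uminus ` S = S"
  shows "I \<in> indep_sets (Cay S) \<longleftrightarrow> (\<forall>u\<in>I. \<forall>v\<in>I. v - u \<notin> S)"
proof -
  have "fst (Cay S) = UNIV"
    by (simp add: Cay_def)
  then show ?thesis
    unfolding indep_sets_def indep_def using assms
    by (auto simp: Cay_adjacent_iff) (metis right_minus_eq)
qed

text \<open>Otherwise \<open>v\<close> could be added to \<open>I\<close>; the symmetry of
  \<open>S\<close> excludes edges in both directions.\<close>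

lemma maximal_indep_set_dominates:
  assumes "0 \<notin> S" and "uminus ` S = S" and I: "I \<in> maximal_indep_sets (Cay S)"
  shows "\<exists>u\<in>I. v - u \<in> insert 0 S"
proof (rule ccontr)
  assume none: "\<not> (\<exists>u\<in>I. v - u \<in> insert 0 S)"
  have "u - v \<notin> S" if "u \<in> I" for u
    using none that assms(2) by (metis image_eqI insertI2 minus_diff_eq)
  with none I have "insert v I \<in> indep_sets (Cay S)"
    unfolding maximal_indep_sets_def by (auto simp: indep_sets_Cay_iff assms(1,2))
  with I have "v \<in> I"
    unfolding maximal_indep_sets_def by blast
  with none show False
    by auto
qed

text \<open>The translates of \<open>insert 0 S\<close> by the points of \<open>I\<close> cover the
  group.\<close>

lemma card_maximal_indep_set_ge:
  fixes S :: "'a::{ab_group_add, finite} set"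
  assumes "0 \<notin> S" and "uminus ` S = S" and "I \<in> maximal_indep_sets (Cay S)"
  shows "CARD('a) \<le> card I * Suc (card S)"
proof -
  have "v \<in> (\<lambda>(u, s). u + s) ` (I \<times> insert 0 S)" for v
  proof -
    obtain u where "u \<in> I" "v - u \<in> insert 0 S"
      using maximal_indep_set_dominates[OF assms] by blast
    then show ?thesis
      by (intro image_eqI[of _ _ "(u, v - u)"]) auto
  qed
  then have "UNIV = (\<lambda>(u, s). u + s) ` (I \<times> insert 0 S)"
    by blast
  then have "CARD('a) \<le> card (I \<times> insert 0 S)"
    by (metis card_image_le finite)
  then show ?thesis
    using assms(1) by (simp add: card_cartesian_product)
qed

section \<open>The connection set\<close>

lemma Z3_cases:
  fixes x :: Z3
  obtains "x = 0" | "x = 1" | "x = 2"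
proof -
  have "(3 :: Z3) = 0"
    by simp
  then show ?thesis
    using that exhaust_3[of x] by metis
qed

lemma Z3_vec_eq_iff: "(u :: Z3 ^ 3) = v \<longleftrightarrow> u $ 1 = v $ 1 \<and> u $ 2 = v $ 2 \<and> u $ 3 = v $ 3"
  by (simp add: vec_eq_iff forall_3)

text \<open>The root system A_3 reduced modulo 3, with \<open>2\<close> in the role of -1. Explicit
  triples let the simplifier decide membership and count elements.\<close>

definition root_coords :: "(Z3 \<times> Z3 \<times> Z3) set" where
  "root_coords = {(1,0,0), (0,1,0), (0,0,1), (2,0,0), (0,2,0), (0,0,2),
    (1,2,0), (2,1,0), (1,0,2), (2,0,1), (0,1,2), (0,2,1)}"

definition roots :: "(Z3 ^ 3) set" where
  "roots = {v. (v $ 1, v $ 2, v $ 3) \<in> root_coords}"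

lemmas roots_simps = roots_def root_coords_def

lemma difference_set_simplex: "difference_set {0, axis 1 1, axis 2 1, axis 3 1} = roots"
proof (rule set_eqI)
  fix v :: "Z3 ^ 3"
  let ?A = "{0, axis 1 1, axis 2 1, axis 3 1} :: (Z3 ^ 3) set"
  have "v \<in> difference_set ?A \<longleftrightarrow> v \<noteq> 0 \<and> (\<exists>x\<in>?A. \<exists>y\<in>?A. v = y - x)"
    unfolding difference_set_def by blast
  also have "\<dots> \<longleftrightarrow> v \<in> roots"
    \<comment> \<open>The quantifiers become a finite disjunction, which is checked for each of the
      27 values of \<open>v\<close>.\<close>
    unfolding bex_simps
    by (cases "v $ 1" rule: Z3_cases; cases "v $ 2" rule: Z3_cases; cases "v $ 3" rule: Z3_cases)
      (simp_all add: Z3_vec_eq_iff axis_def roots_simps)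
  finally show "v \<in> difference_set ?A \<longleftrightarrow> v \<in> roots" .
qed

lemma explicit_roots:
  "(\<Union>i. \<Union>j \<in> {j. i \<noteq> j}.
      {axis i 1, - axis i 1, axis i 1 - axis j 1, - (axis i 1 - axis j 1)}) = roots" (is "?L = _")
proof (rule set_eqI)
  fix v :: "Z3 ^ 3"
  have ex_3: "(\<exists>i::3. P i) \<longleftrightarrow> P 1 \<or> P 2 \<or> P 3" for P
    using forall_3[of "\<lambda>i. \<not> P i"] by blast
  have "v \<in> ?L \<longleftrightarrow> (\<exists>i j. i \<noteq> j \<and>
      (v = axis i 1 \<or> v = - axis i 1 \<or> v = axis i 1 - axis j 1 \<or> v = - (axis i 1 - axis j 1)))"
    by blast
  also have "\<dots> \<longleftrightarrow> v \<in> roots"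
    unfolding ex_3
    by (cases "v $ 1" rule: Z3_cases; cases "v $ 2" rule: Z3_cases; cases "v $ 3" rule: Z3_cases)
      (simp_all add: Z3_vec_eq_iff axis_def roots_simps)
  finally show "v \<in> ?L \<longleftrightarrow> v \<in> roots" .
qed

lemma card_roots_le: "card roots \<le> 12"
proof -
  have "card roots \<le> card root_coords"
    by (rule card_inj_on_le[where f = "\<lambda>v. (v $ 1, v $ 2, v $ 3)"])
      (auto simp: inj_on_def Z3_vec_eq_iff roots_def)
  also have "\<dots> = 12"
    by (simp add: root_coords_def)
  finally show ?thesis .
qed

lemma zero_notin_roots: "0 \<notin> roots"
  and uminus_roots: "uminus ` roots = roots"
  by (simp_all flip: difference_set_simplex add: zero_notin_difference_set uminus_difference_set)

lemma indep_sets_roots_iff: "I \<in> indep_sets (Cay roots) \<longleftrightarrow> (\<forall>u\<in>I. \<forall>v\<in>I. v - u \<notin> roots)"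
  by (simp add: indep_sets_Cay_iff zero_notin_roots uminus_roots)

section \<open>Classes of equal coordinate sum\<close>

text \<open>A homomorphism that kills the all-ones vector \<open>1\<close> (called \<open>d\<close>
  above), hence is constant on the cosets of \<open>{0, 1, - 1}\<close>.\<close>

definition coord_sum :: "Z3 ^ 3 \<Rightarrow> Z3" where
  "coord_sum v = v $ 1 + v $ 2 + v $ 3"

lemma coord_sum_diff: "coord_sum (u - v) = coord_sum u - coord_sum v"
  by (simp add: coord_sum_def)

text \<open>The kernel has nine elements: the six differences of distinct basis vectors and the
  three multiples of \<open>1\<close>.\<close>

lemma coord_sum_0_cases: "coord_sum v = 0 \<Longrightarrow> v \<in> roots \<or> v \<in> {0, 1, - 1}"
  by (cases "v $ 1" rule: Z3_cases; cases "v $ 2" rule: Z3_cases; cases "v $ 3" rule: Z3_cases)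
    (simp_all add: coord_sum_def roots_simps Z3_vec_eq_iff)

text \<open>The vectors of sum \<open>1\<close> form three cosets of \<open>{0, 1, - 1}\<close>,
  each containing one basis vector; for sum \<open>2\<close> take negatives.\<close>

lemma coset_meets_roots:
  "coord_sum v \<noteq> 0 \<Longrightarrow> v \<in> roots \<or> v + 1 \<in> roots \<or> v - 1 \<in> roots"
  by (cases "v $ 1" rule: Z3_cases; cases "v $ 2" rule: Z3_cases; cases "v $ 3" rule: Z3_cases)
    (simp_all add: coord_sum_def roots_simps)

lemma same_class_cases:
  assumes "I \<in> indep_sets (Cay roots)" "x \<in> I" "y \<in> I" "coord_sum x = coord_sum y"
  shows "y \<in> {x, x + 1, x - 1}"
proof -
  have "coord_sum (y - x) = 0"
    using assms(4) by (simp add: coord_sum_diff)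
  moreover have "y - x \<notin> roots"
    using assms(1-3) by (simp add: indep_sets_roots_iff)
  ultimately have "y - x \<in> {0, 1, - 1}"
    using coord_sum_0_cases by blast
  then show ?thesis
    by (auto simp: algebra_simps)
qed

lemma class_unique_if_other_class_pair:
  assumes I: "I \<in> indep_sets (Cay roots)"
    and x: "x \<in> I" "y \<in> I" "x \<noteq> y" "coord_sum x = coord_sum y"
    and z: "z \<in> I" "w \<in> I" "coord_sum z = coord_sum w" "coord_sum z \<noteq> coord_sum x"
  shows "z = w"
proof (rule ccontr)
  assume "z \<noteq> w"
  let ?u = "z - x"
  have three: "(1 :: Z3 ^ 3) + 1 = - 1"
    by (simp add: Z3_vec_eq_iff)
  have "y = x + 1 \<or> y = x - 1"
    using same_class_cases[OF I x(1,2,4)] x(3) by blast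
  moreover have "w = z + 1 \<or> w = z - 1"
    using same_class_cases[OF I z(1,2,3)] \<open>z \<noteq> w\<close> by blast
  \<comment> \<open>Let \<open>y = x + s\<close> and \<open>w = z + t\<close> with \<open>s\<close>
    and \<open>t\<close> in \<open>{1, - 1}\<close>. Then \<open>z - y = ?u - s\<close>. The value
    \<open>?u + s\<close> is \<open>w - x\<close> if \<open>t = s\<close>, and
    \<open>w - y = ?u - s - s\<close> if \<open>t = - s\<close>. So differences within
    \<open>I\<close> fill the coset of \<open>?u\<close>.\<close>
  ultimately have "?u + 1 \<in> {z - y, w - x, w - y}" "?u - 1 \<in> {z - y, w - x, w - y}"
    using three by (auto simp: algebra_simps)
  then have "?u \<notin> roots" "?u + 1 \<notin> roots" "?u - 1 \<notin> roots"
    using I x(1,2) z(1,2) unfolding indep_sets_roots_iff by fastforce+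
  moreover have "coord_sum ?u \<noteq> 0"
    using z(4) by (simp add: coord_sum_diff)
  ultimately show False
    using coset_meets_roots by blast
qed

text \<open>The differences from \<open>z\<close> to the three points form the whole coset of
  \<open>z - x\<close>, and none of them is a root.\<close>

lemma coord_sum_eq_if_full_class:
  assumes I: "I \<in> indep_sets (Cay roots)" and "{x, x + 1, x - 1} \<subseteq> I" "z \<in> I"
  shows "coord_sum z = coord_sum x"
proof -
  have "z - x \<notin> roots" "z - (x - 1) \<notin> roots" "z - (x + 1) \<notin> roots"
    using assms unfolding indep_sets_roots_iff by blast+
  then have "coord_sum (z - x) = 0"
    using coset_meets_roots[of "z - x"] by (auto simp: algebra_simps)
  then show ?thesis
    by (simp add: coord_sum_diff)
qed

lemma card_indep_set_le:
  assumes I: "I \<in> indep_sets (Cay roots)"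
  shows "card I \<le> 4"
proof (cases "inj_on coord_sum I")
  case True
  then have "card I \<le> CARD(Z3)"
    by (intro card_inj_on_le[of coord_sum]) auto
  then show ?thesis
    by simp
next
  case False
  then obtain x y where xy: "x \<in> I" "y \<in> I" "x \<noteq> y" "coord_sum x = coord_sum y"
    unfolding inj_on_def by blast
  define F where "F = {z \<in> I. coord_sum z = coord_sum x}"
  have F: "F \<subseteq> {x, x + 1, x - 1}"
    using same_class_cases[OF I xy(1)] unfolding F_def by fastforce
  have card3: "card {x, x + 1, x - 1} \<le> 3"
    by (simp add: card_insert_if)
  \<comment> \<open>\<open>F\<close> is a class with at least two points, so each of the two other
    classes contributes at most one.\<close>
  have "inj_on coord_sum (I - F)"
    using class_unique_if_other_class_pair[OF I xy] by (auto simp: inj_on_def F_def)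
  moreover have "coord_sum ` (I - F) \<subseteq> UNIV - {coord_sum x}"
    by (auto simp: F_def)
  ultimately have "card (I - F) \<le> card (UNIV - {coord_sum x})"
    by (intro card_inj_on_le[of coord_sum]) auto
  then have outside: "card (I - F) \<le> 2"
    by (simp add: card_Diff_singleton)
  have "card I = card F + card (I - F)"
    by (metis (no_types, lifting) F_def card_Diff_subset card_mono finite le_add_diff_inverse
        mem_Collect_eq subsetI)
  \<comment> \<open>A point outside \<open>F\<close> prevents \<open>F\<close> from being a full
    coset. The total is thus at most 2 + 2 or 3 + 0.\<close>
  moreover have "card F \<le> 2" if "I - F \<noteq> {}"
  proof -
    have "F \<noteq> {x, x + 1, x - 1}"
      using coord_sum_eq_if_full_class[OF I, of x] that by (auto simp: F_def)
    with F have "card F < card {x, x + 1, x - 1}"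
      by (intro psubset_card_mono) auto
    with card3 show ?thesis
      by linarith
  qed
  moreover have "card F \<le> 3"
    using F card3 by (meson card_mono finite order_trans)
  ultimately show ?thesis
    using outside by (cases "I - F = {}") auto
qed

section \<open>The two parameters\<close>

lemma independence_number_roots: "independence_number (Cay roots) = 4"
  unfolding independence_number_def
proof (rule Max_eqI)
  \<comment> \<open>The extremal shape: two points of sum \<open>0\<close> and one each of sums
    \<open>1\<close> and \<open>2\<close>. The last two are \<open>axis 1 1 - 1\<close> and
    \<open>- axis 2 1 - 1\<close>; their root differences to the diagonal occur only at the omitted
    point \<open>- 1\<close>.\<close>
  let ?I = "{0, 1, - axis 2 1 - axis 3 1, 1 + axis 1 1 + axis 3 1} :: (Z3 ^ 3) set"
  have "?I \<in> indep_sets (Cay roots)"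
    unfolding indep_sets_roots_iff by (simp add: roots_simps axis_def)
  moreover have "card ?I = 4"
    by (simp add: Z3_vec_eq_iff axis_def)
  ultimately show "4 \<in> card ` indep_sets (Cay roots)"
    by (metis image_eqI)
qed (auto simp: card_indep_set_le)

text \<open>A full class: an independent superset can neither leave the class nor gain points inside
  it.\<close>

lemma diagonal_maximal_indep: "{0, 1, - 1} \<in> maximal_indep_sets (Cay roots)"
proof -
  have "{0, 1, - 1} \<in> indep_sets (Cay roots)"
    unfolding indep_sets_roots_iff by (simp add: roots_simps)
  moreover have "J = {0, 1, - 1}" if J: "J \<in> indep_sets (Cay roots)" "{0, 1, - 1} \<subseteq> J" for J
  proof -
    have "z \<in> {0, 1, - 1}" if "z \<in> J" for z
      using coord_sum_eq_if_full_class[OF J(1), of 0 z] same_class_cases[OF J(1), of 0 z] J(2) that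
      by auto
    with J(2) show ?thesis
      by blast
  qed
  ultimately show ?thesis
    unfolding maximal_indep_sets_def by blast
qed

lemma indep_domination_number_roots: "indep_domination_number (Cay roots) = 3"
  unfolding indep_domination_number_def
proof (rule Min_eqI)
  have "card {0, 1, - 1 :: Z3 ^ 3} = 3"
    by (simp add: Z3_vec_eq_iff)
  then show "3 \<in> card ` maximal_indep_sets (Cay roots)"
    using diagonal_maximal_indep by (metis image_eqI)
next
  fix n
  assume "n \<in> card ` maximal_indep_sets (Cay roots)"
  then obtain I where I: "I \<in> maximal_indep_sets (Cay roots)" "n = card I"
    by blast
  have "27 = CARD(Z3 ^ 3)"
    by simp
  also have "\<dots> \<le> n * Suc (card roots)"
    using card_maximal_indep_set_ge[OF zero_notin_roots uminus_roots I(1)] I(2) by simp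
  also have "\<dots> \<le> n * 13"
    using card_roots_le by (intro mult_left_mono) auto
  finally show "3 \<le> n"
    by linarith
qed simp

theorem lemma12:
  fixes A S :: "(Z3 ^ 3) set"
  assumes "A = {0, axis 1 1, axis 2 1, axis 3 1}"
    and "S = difference_set A"
  shows "S = (\<Union>i. \<Union>j \<in> {j. i \<noteq> j}.
      {axis i 1, - axis i 1, axis i 1 - axis j 1, - (axis i 1 - axis j 1)})
    \<and> indep_domination_number (Cay S) = 3
    \<and> independence_number (Cay S) = 4"
proof -
  have "S = roots"
    using assms difference_set_simplex by simp
  then show ?thesis
    by (simp only: explicit_roots indep_domination_number_roots independence_number_roots)
qed

end
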